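(* Let $n\ge 1$ and let $f_l(z)=z^n+q_{n-1}z^{n-1}+\cdots+q_1z+q_0$ be a monic left polynomial of degree $n$ over the quaternions $\mathbb{H}$, with coefficients $q_0,\dots,q_{n-1}\in\mathbb{H}$. Then every zero $z\in\mathbb{H}$ of $f_l$ satisfies $$\left|z+\frac{q_{n-1}}{2}\right|\le\left|\frac{q_{n-1}}{2}\right|+\sum_{i=2}^{n}|q_{n-i}|^{\frac1i}.$$
   Context: $\mathbb{H}=\{a+bi+cj+dk: a,b,c,d\in\mathbb{R}\}$ is the skew field of real quaternions, with modulus $|a+bi+cj+dk|=\sqrt{a^2+b^2+c^2+d^2}$. A left quaternionic polynomial has its coefficients to the left of the powers of the variable; it is evaluated at $z\in\mathbb{H}$ as $f_l(z)=\sum_{i=0}^n q_iz^i$ (here $q_n=1$) using quaternion multiplication, and a zero of $f_l$ is a $z\in\mathbb{H}$ with $f_l(z)=0$. *)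

theory Defs
  imports "HOL-Analysis.Analysis" "HOL-Computational_Algebra.Polynomial"
begin

section \<open>The skew field of real quaternions\<close>

text \<open>\<open>Quat a b c d\<close> is the quaternion \<open>a + b i + c j + d k\<close>.\<close>

codatatype quat = Quat (Q1: real) (Qi: real) (Qj: real) (Qk: real)

lemma quat_eq_iff: "x = y \<longleftrightarrow> Q1 x = Q1 y \<and> Qi x = Qi y \<and> Qj x = Qj y \<and> Qk x = Qk y"
  by (auto intro: quat.expand)

instantiation quat :: ab_group_add
begin

primcorec zero_quat where
  "Q1 0 = 0" | "Qi 0 = 0" | "Qj 0 = 0" | "Qk 0 = 0"

primcorec plus_quat where
  "Q1 (x + y) = Q1 x + Q1 y"
| "Qi (x + y) = Qi x + Qi y"
| "Qj (x + y) = Qj x + Qj y"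
| "Qk (x + y) = Qk x + Qk y"

primcorec uminus_quat where
  "Q1 (- x) = - Q1 x" | "Qi (- x) = - Qi x" | "Qj (- x) = - Qj x" | "Qk (- x) = - Qk x"

primcorec minus_quat where
  "Q1 (x - y) = Q1 x - Q1 y"
| "Qi (x - y) = Qi x - Qi y"
| "Qj (x - y) = Qj x - Qj y"
| "Qk (x - y) = Qk x - Qk y"

instance
  by standard (simp_all add: quat_eq_iff)

end

instantiation quat :: ring_1
begin

primcorec one_quat where
  "Q1 1 = 1" | "Qi 1 = 0" | "Qj 1 = 0" | "Qk 1 = 0"

text \<open>Hamilton's rules \<open>i\<^sup>2 = j\<^sup>2 = k\<^sup>2 = i j k = -1\<close>, extended bilinearly.\<close>

primcorec times_quat where
  "Q1 (x * y) = Q1 x * Q1 y - Qi x * Qi y - Qj x * Qj y - Qk x * Qk y"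
| "Qi (x * y) = Q1 x * Qi y + Qi x * Q1 y + Qj x * Qk y - Qk x * Qj y"
| "Qj (x * y) = Q1 x * Qj y - Qi x * Qk y + Qj x * Q1 y + Qk x * Qi y"
| "Qk (x * y) = Q1 x * Qk y + Qi x * Qj y - Qj x * Qi y + Qk x * Q1 y"

instance
  by standard (simp_all add: quat_eq_iff algebra_simps)

end

lemma
  defines "i \<equiv> Quat 0 1 0 0" and "j \<equiv> Quat 0 0 1 0" and "k \<equiv> Quat 0 0 0 1"
  shows quat_units_square: "i * i = -1" "j * j = -1" "k * k = -1"
    and quat_units_mult: "i * j = k" "j * k = i" "k * i = j" "j * i = - k" "k * j = - i" "i * k = - j"
  by (simp_all add: assms quat_eq_iff)

instantiation quat :: real_algebra_1
begin

primcorec scaleR_quat where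
  "Q1 (r *\<^sub>R x) = r * Q1 x"
| "Qi (r *\<^sub>R x) = r * Qi x"
| "Qj (r *\<^sub>R x) = r * Qj x"
| "Qk (r *\<^sub>R x) = r * Qk x"

instance
  by standard (simp_all add: quat_eq_iff algebra_simps)

end

instantiation quat :: real_normed_algebra_1
begin

definition norm_quat_def:
  "norm (x::quat) = sqrt ((Q1 x)\<^sup>2 + (Qi x)\<^sup>2 + (Qj x)\<^sup>2 + (Qk x)\<^sup>2)"

definition sgn_quat_def:
  "sgn (x::quat) = x /\<^sub>R norm x"

definition dist_quat_def:
  "dist (x::quat) y = norm (x - y)"

definition uniformity_quat_def:
  "(uniformity :: (quat \<times> quat) filter) = (INF e\<in>{0 <..}. principal {(x, y). dist x y < e})"

definition open_quat_def:
  "open (U::quat set) \<longleftrightarrow> (\<forall>x\<in>U. eventually (\<lambda>(x', y). x' = x \<longrightarrow> y \<in> U) uniformity)"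

lemma norm_quat_mult: "norm (x * y) = norm x * norm (y::quat)"
  unfolding norm_quat_def real_sqrt_mult [symmetric]
  by (rule arg_cong [where f = sqrt]) (simp add: power2_eq_square algebra_simps)

instance
proof
  fix r :: real and x y :: quat and U :: "quat set"
  have norm_eq: "norm q = norm ((Q1 q, Qi q), (Qj q, Qk q))" for q :: quat
    by (simp add: norm_quat_def norm_Pair)
  show "norm (x + y) \<le> norm x + norm y"
    using norm_triangle_ineq [of "((Q1 x, Qi x), (Qj x, Qk x))" "((Q1 y, Qi y), (Qj y, Qk y))"]
    unfolding norm_eq by simp
  show "norm x = 0 \<longleftrightarrow> x = 0"
    unfolding norm_eq by (simp add: quat_eq_iff zero_prod_def)
  show "norm (r *\<^sub>R x) = \<bar>r\<bar> * norm x"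
    unfolding norm_eq using norm_scaleR [of r "((Q1 x, Qi x), (Qj x, Qk x))"] by simp
  show "norm (x * y) \<le> norm x * norm y"
    by (simp add: norm_quat_mult)
  show "norm (1::quat) = 1"
    by (simp add: norm_quat_def)
qed (rule sgn_quat_def dist_quat_def open_quat_def uniformity_quat_def)+

end

instantiation quat :: division_ring
begin

definition inverse_quat_def:
  "inverse (x::quat) = Quat (Q1 x) (- Qi x) (- Qj x) (- Qk x) /\<^sub>R (norm x)\<^sup>2"

definition divide_quat_def:
  "divide (x::quat) y = x * inverse y"

instance
proof
  fix x y :: quat
  let ?s = "(Q1 x)\<^sup>2 + (Qi x)\<^sup>2 + (Qj x)\<^sup>2 + (Qk x)\<^sup>2"
  let ?c = "Quat (Q1 x) (- Qi x) (- Qj x) (- Qk x)"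
  have s: "(norm x)\<^sup>2 = ?s"
    by (simp add: norm_quat_def)
  have c: "?c * x = ?s *\<^sub>R 1" "x * ?c = ?s *\<^sub>R 1"
    by (simp_all add: quat_eq_iff power2_eq_square)
  show "inverse x * x = 1" if "x \<noteq> 0"
    using that by (simp add: inverse_quat_def c flip: s)
  show "x * inverse x = 1" if "x \<noteq> 0"
    using that by (simp add: inverse_quat_def c flip: s)
  show "inverse (0::quat) = 0"
    by (simp add: inverse_quat_def)
  show "divide x y = x * inverse y"
    by (simp add: divide_quat_def)
qed

end

instance quat :: real_normed_div_algebra
  by standard (rule norm_quat_mult)

section \<open>Left polynomials\<close>

text \<open>
  A left polynomial is represented by its sequence of coefficients, as an element of the type
  \<open>quat poly\<close>. The library's \<open>poly\<close> evaluates over commutative semirings only, so evaluation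
  is defined separately, with the coefficients to the left of the powers.
\<close>

definition left_eval :: "'a::ring_1 poly \<Rightarrow> 'a \<Rightarrow> 'a" where
  "left_eval f z = (\<Sum>i\<le>degree f. coeff f i * z ^ i)"

end

(* Put S = \<Sum>i=2..n. |q_(n-i)|^(1/i). The zero satisfies
   (z + q_(n-1)) z^(n-1) = - \<Sum>i=2..n. q_(n-i) z^(n-i). If |z| > S, then every
   a = |q_(n-i)|^(1/i) is at most |z|, so |q_(n-i)| |z|^(n-i) = a^i |z|^(n-i) \<le> a |z|^(n-1),
   and dividing by |z|^(n-1) gives |z + q_(n-1)| \<le> S. Hence one of z and z + q_(n-1) has
   modulus at most S, and both differ from z + q_(n-1)/2 by \<plusminus> q_(n-1)/2. *)
theory Submission
  imports Defs
begin

text \<open>Reversing the summation index lists the terms by descending degree; as coefficients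
  stand on the left, the top two share the right factor \<open>z ^ (n - 1)\<close>.\<close>

lemma left_eval_top_two:
  assumes "degree f = n" and "n \<ge> 1"
  shows "left_eval f z =
    (lead_coeff f * z + coeff f (n - 1)) * z ^ (n - 1) + (\<Sum>i=2..n. coeff f (n - i) * z ^ (n - i))"
proof -
  have "left_eval f z = (\<Sum>i\<le>n. coeff f (n - i) * z ^ (n - i))"
    unfolding left_eval_def assms(1)
    by (rule sum.reindex_bij_witness [where i = "\<lambda>i. n - i" and j = "\<lambda>i. n - i"]) auto
  \<comment> \<open>Index 1 lies in the range because \<open>n \<ge> 1\<close>; for
    \<open>n = 1\<close> the rest \<open>{2..n}\<close> is empty.\<close>
  also have "{..n} = insert 0 (insert 1 {2..n})"
    using assms(2) by auto
  also have "(\<Sum>i\<in>insert 0 (insert 1 {2..n}). coeff f (n - i) * z ^ (n - i))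
    = coeff f n * z ^ n + (coeff f (n - 1) * z ^ (n - 1)
        + (\<Sum>i=2..n. coeff f (n - i) * z ^ (n - i)))"
    by simp
  also have "z ^ n = z * z ^ (n - 1)"
    using assms(2) by (simp flip: power_Suc)
  finally show ?thesis
    by (simp add: assms(1) distrib_right mult.assoc)
qed

text \<open>Multiplicativity of the norm turns the factored equation into an inequality of reals, so
  commutativity never enters.\<close>

lemma norm_zero_or_shifted_zero_le:
  fixes f :: "'a::real_normed_div_algebra poly"
  assumes deg: "degree f = n" "n \<ge> 1" and monic: "lead_coeff f = 1" and zero: "left_eval f z = 0"
  defines "S \<equiv> \<Sum>i=2..n. norm (coeff f (n - i)) powr (1 / real i)"
  shows "norm z \<le> S \<or> norm (z + coeff f (n - 1)) \<le> S"
  unfolding disj_imp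
proof
  assume "\<not> norm z \<le> S"
  then have large: "S < norm z"
    by simp
  define a where "a i = norm (coeff f (n - i)) powr (1 / real i)" for i
  have S: "S = (\<Sum>i=2..n. a i)"
    by (simp add: S_def a_def)
  have a_nonneg: "0 \<le> a i" for i
    by (simp add: a_def)
  then have "0 \<le> S"
    by (simp add: S sum_nonneg)
  \<comment> \<open>Strict positivity allows \<open>norm z ^ (n - 1)\<close> to be cancelled at the
    end.\<close>
  with large have pos: "0 < norm z"
    by linarith
  have term_le: "norm (coeff f (n - i) * z ^ (n - i)) \<le> a i * norm z ^ (n - 1)"
    if i: "i \<in> {2..n}" for i
  proof -
    have "a i \<le> S"
      unfolding S by (rule member_le_sum) (use i a_nonneg in auto)
    with large have "a i \<le> norm z"
      by linarith
    then have le: "a i ^ (i - 1) \<le> norm z ^ (i - 1)"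
      by (intro power_mono a_nonneg)
    have exponents: "n - 1 = i - 1 + (n - i)"
      using i by auto
    have "0 < i"
      using i by auto
    \<comment> \<open>\<open>a i\<close> is an \<open>i\<close>-th root. One factor is split off to
      contribute to \<open>S\<close>; the other \<open>i - 1\<close> are bounded by
      \<open>norm z\<close>.\<close>
    then have "norm (coeff f (n - i)) = a i * a i ^ (i - 1)"
      by (simp add: a_def flip: root_powr_inverse power_Suc)
    then have "norm (coeff f (n - i) * z ^ (n - i)) = a i * (a i ^ (i - 1) * norm z ^ (n - i))"
      by (simp only: norm_mult norm_power mult.assoc)
    also have "\<dots> \<le> a i * (norm z ^ (i - 1) * norm z ^ (n - i))"
      by (intro mult_right_mono mult_left_mono a_nonneg le) auto
    also have "\<dots> = a i * norm z ^ (n - 1)"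
      by (simp only: exponents power_add)
    finally show ?thesis .
  qed
  have "(z + coeff f (n - 1)) * z ^ (n - 1) = - (\<Sum>i=2..n. coeff f (n - i) * z ^ (n - i))"
    using zero left_eval_top_two [OF deg, of z] by (simp add: monic eq_neg_iff_add_eq_0)
  then have "norm (z + coeff f (n - 1)) * norm z ^ (n - 1)
      = norm (\<Sum>i=2..n. coeff f (n - i) * z ^ (n - i))"
    by (simp only: norm_minus_cancel flip: norm_mult norm_power)
  also have "\<dots> \<le> (\<Sum>i=2..n. a i * norm z ^ (n - 1))"
    by (rule sum_norm_le) (rule term_le)
  also have "\<dots> = S * norm z ^ (n - 1)"
    by (simp add: S sum_distrib_right)
  finally show "norm (z + coeff f (n - 1)) \<le> S"
    using pos by simp
qed

theorem theorem4p1: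
  fixes n :: nat and f :: "quat poly" and z :: quat
  assumes "n \<ge> 1"
    and "degree f = n" and "lead_coeff f = 1"
    and "left_eval f z = 0"
  shows "norm (z + coeff f (n - 1) / 2)
           \<le> norm (coeff f (n - 1) / 2) + (\<Sum>i = 2..n. norm (coeff f (n - i)) powr (1 / real i))"
proof -
  let ?h = "coeff f (n - 1) / 2"
  have halves: "?h + ?h = coeff f (n - 1)"
    \<comment> \<open>Division multiplies by the inverse on the right, so the identity first appears
      as \<open>?h * 2\<close>.\<close>
    using nonzero_eq_divide_eq [of 2 ?h "coeff f (n - 1)"] by (simp add: mult_2_right)
  have "norm (z + ?h) \<le> norm z + norm ?h"
    by (rule norm_triangle_ineq)
  moreover have "z + ?h = z + coeff f (n - 1) - ?h"
    by (metis halves add.assoc add_diff_cancel_right')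
  then have "norm (z + ?h) \<le> norm (z + coeff f (n - 1)) + norm ?h"
    by (metis norm_triangle_ineq4)
  ultimately show ?thesis
    using norm_zero_or_shifted_zero_le [OF assms(2,1,3,4)] by linarith
qed

end
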